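(* Let $i\in\{1,\dots,k-1\}$, let $\prec$ be a linear order on $\{1,2,\dots,\lambda_i\}=\{a_1,\dots,a_{\lambda_i}\}$ with $a_1\prec a_2\prec\dots\prec a_{\lambda_i}$, and let $\mu=(\mu_1,\mu_2,\dots)$ be a composition of $\lambda_i$ with non-zero parts. Then the restrictions of the actions of the generators $E_i$ and $F_i$ of $U_\lambda$ from $\Omega$ to $\mathbf R$ are given by the operators $$E_i=\sum_j\partial(\mu,j)\circ f(\mu,j)^{+}\circ\varphi_{(i,a_{\min(\mu_j)})},\qquad F_i=\sum_j\partial(\mu,j)\circ f(\mu,j)^{-}\circ\varphi_{(i,a_{\min(\mu_j)})}^{-1},$$ where $j$ runs over the (indices of the) parts of $\mu$, and the rational functions $f(\mu,j)^{\pm}$ act by multiplication.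
   Context: Let $k\ge 1$ and let $\lambda=(\lambda_1,\dots,\lambda_k)$ be positive integers. Let $I$ be the set of pairs $(i,j)$ with $1\le i\le k$, $1\le j\le \lambda_i$; for $1\le i\le k$ let $I^{(i)}=\{(i,j):1\le j\le\lambda_i\}$, and put $I^{(0)}=\emptyset$ (a product over the empty set is $1$). Let $\Omega=\mathbb{C}(x_{\mathbf a}:\mathbf a\in I)$ and $R=\mathbb{C}[x_{\mathbf a}:\mathbf a\in I]\subset\Omega$. For $\mathbf a\in I$, $\varphi_{\mathbf a}$ is the $\mathbb{C}$-automorphism of the field $\Omega$ with $\varphi_{\mathbf a}(x_{\mathbf b})=x_{\mathbf b}+\delta_{\mathbf a,\mathbf b}$. For $i=1,\dots,k-1$ the operators $E_i,F_i$ on $\Omega$ are $$E_i=\sum_{j=1}^{\lambda_i}\frac{\prod_{\mathbf a\in I^{(i+1)}}(x_{(i,j)}-x_{\mathbf a})}{\prod_{\mathbf b\in I^{(i)}\setminus\{(i,j)\}}(x_{(i,j)}-x_{\mathbf b})}\varphi_{(i,j)},\qquad F_i=\sum_{j=1}^{\lambda_i}\frac{\prod_{\mathbf a\in I^{(i-1)}}(x_{(i,j)}-x_{\mathbf a})}{\prod_{\mathbf b\in I^{(i)}\setminus\{(i,j)\}}(x_{(i,j)}-x_{\mathbf b})}\varphi_{(i,j)}^{-1}.$$ These, together with multiplications by the elementary symmetric polynomials in each set $\{x_{\mathbf b}:\mathbf b\in I^{(l)}\}$, $1\le l\le k$, generate the orthogonal Gelfand-Zeitlin algebra $U_\lambda$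 of operators on $\Omega$. The group $G=S_{\lambda_1}\times\dots\times S_{\lambda_k}$ acts on $\Omega$ and $R$, with $S_{\lambda_l}$ permuting $x_{(l,1)},\dots,x_{(l,\lambda_l)}$; $\mathbf R:=R^G$. For different $\mathbf a,\mathbf b\in I^{(i)}$, let $(\mathbf a,\mathbf b)$ be the transposition swapping $x_{\mathbf a}$ and $x_{\mathbf b}$, and $\partial_{\mathbf a,\mathbf b}=\frac{\mathrm{id}-(\mathbf a,\mathbf b)}{x_{\mathbf a}-x_{\mathbf b}}:\Omega\to\Omega$ the divided difference operator. Given $i$ and $\prec$, for $a\prec b$ in $\{1,\dots,\lambda_i\}$ write $\partial_{(a,b)}:=\partial_{(i,a),(i,b)}$. For a part $\mu_j$ of $\mu$, put $\min(\mu_j)=\mu_1+\dots+\mu_{j-1}+1$ and let $\underline{\mu_j}=\{a_{\min(\mu_j)},a_{\min(\mu_j)+1},\dots,a_{\min(\mu_j)+\mu_j-1}\}$, also regarded as the subset $\{(i,a):a\in\underline{\mu_j}\}$ of $I^{(i)}$. If $\mu_j=1$, $\partial(\mu,j)$ is the identity operator; if $\mu_j>1$, $$\partial(\mu,j)=\partial_{(a_{\min(\mu_j)+\mu_j-2},\,a_{\min(\mu_j)+\mu_j-1})}\circ\cdots\circ\partial_{(a_{\min(\mu_j)+1},\,a_{\min(\mu_j)+2})}\circ\partial_{(a_{\min(\mu_j)},\,a_{\min(\mu_j)+1})}.$$ Finally, $$f(\mu,j)^{\pm}=\frac{\prod_{\mathbf a\in I^{(i\pm1)}}(x_{(i,a_{\min(\mu_j)})}-x_{\mathbf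 a})}{\prod_{\mathbf b\in I^{(i)}\setminus\underline{\mu_j}}(x_{(i,a_{\min(\mu_j)})}-x_{\mathbf b})}.$$ *)

theory Defs
  imports
    Complex_Main
    "HOL-Library.Poly_Mapping"
    "HOL-Library.Product_Lexorder"
    "HOL-Computational_Algebra.Fraction_Field"
    "HOL-Combinatorics.Permutations"
begin

text \<open>
  The index set \<open>I\<close> depends on the composition \<open>\<lambda>\<close>. The rational functions in the variables
  \<open>x\<^sub>a\<close>, \<open>a \<in> I\<close>, are therefore taken inside one fixed field: the fraction field of the polynomial
  ring over the complex numbers in variables indexed by all pairs of natural numbers. The
  lexicographic order on pairs only serves to obtain the class instance \<open>idom\<close> for the
  polynomial ring.
\<close>

type_synonym var = "nat \<times> nat"
type_synonym mpoly = "(var \<Rightarrow>\<^sub>0 nat) \<Rightarrow>\<^sub>0 complex"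
type_synonym ratfun = "mpoly fract"

definition Const :: "complex \<Rightarrow> mpoly" where
  "Const c = Poly_Mapping.single 0 c"

definition Var :: "var \<Rightarrow> mpoly" where
  "Var v = Poly_Mapping.single (Poly_Mapping.single v 1) 1"

definition vars :: "mpoly \<Rightarrow> var set" where
  "vars p = (\<Union>m\<in>Poly_Mapping.keys p. Poly_Mapping.keys m)"

definition of_mpoly :: "mpoly \<Rightarrow> ratfun" where
  "of_mpoly p = Fract p 1"

definition X :: "var \<Rightarrow> ratfun" where
  "X v = of_mpoly (Var v)"

definition subst_monom :: "(var \<Rightarrow> mpoly) \<Rightarrow> (var \<Rightarrow>\<^sub>0 nat) \<Rightarrow> mpoly" where
  "subst_monom s m = (\<Prod>v\<in>Poly_Mapping.keys m. s v ^ Poly_Mapping.lookup m v)"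

definition subst :: "(var \<Rightarrow> mpoly) \<Rightarrow> mpoly \<Rightarrow> mpoly" where
  "subst s p = (\<Sum>m\<in>Poly_Mapping.keys p. Const (Poly_Mapping.lookup p m) * subst_monom s m)"

text \<open>
  The extension of a map of polynomials to fractions. It is only used for injective ring
  homomorphisms \<open>h\<close>, for which the description is independent of the representing fraction,
  see \<open>map_fract_Fract\<close> below.
\<close>

definition map_fract :: "(mpoly \<Rightarrow> mpoly) \<Rightarrow> ratfun \<Rightarrow> ratfun" where
  "map_fract h f = (THE g. \<exists>p q. q \<noteq> 0 \<and> f = Fract p q \<and> g = Fract (h p) (h q))"

definition phi :: "var \<Rightarrow> ratfun \<Rightarrow> ratfun" where
  "phi a = map_fract (subst (\<lambda>b. Var b + (if b = a then 1 else 0)))"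

definition perm_act :: "(var \<Rightarrow> var) \<Rightarrow> ratfun \<Rightarrow> ratfun" where
  "perm_act \<pi> = map_fract (subst (\<lambda>b. Var (\<pi> b)))"

text \<open>\<open>row lam i\<close> is \<open>I\<^sup>(\<^sup>i\<^sup>)\<close>, with the convention that \<open>I\<^sup>(\<^sup>0\<^sup>)\<close> is empty.\<close>

definition row :: "(nat \<Rightarrow> nat) \<Rightarrow> nat \<Rightarrow> var set" where
  "row lam i = (if i = 0 then {} else {i} \<times> {1..lam i})"

definition idx :: "nat \<Rightarrow> (nat \<Rightarrow> nat) \<Rightarrow> var set" where
  "idx k lam = (\<Union>i\<in>{1..k}. row lam i)"

definition polys :: "nat \<Rightarrow> (nat \<Rightarrow> nat) \<Rightarrow> ratfun set" where
  "polys k lam = of_mpoly ` {p. vars p \<subseteq> idx k lam}"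

definition GG :: "nat \<Rightarrow> (nat \<Rightarrow> nat) \<Rightarrow> (var \<Rightarrow> var) set" where
  "GG k lam = {\<pi>. \<pi> permutes idx k lam \<and> (\<forall>b\<in>idx k lam. fst (\<pi> b) = fst b)}"

definition sym_polys :: "nat \<Rightarrow> (nat \<Rightarrow> nat) \<Rightarrow> ratfun set" where
  "sym_polys k lam = {f \<in> polys k lam. \<forall>\<pi>\<in>GG k lam. perm_act \<pi> f = f}"

definition E_op :: "(nat \<Rightarrow> nat) \<Rightarrow> nat \<Rightarrow> ratfun \<Rightarrow> ratfun" where
  "E_op lam i g = (\<Sum>j\<in>{1..lam i}.
     (\<Prod>a\<in>row lam (i + 1). X (i, j) - X a) / (\<Prod>b\<in>row lam i - {(i, j)}. X (i, j) - X b)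
       * phi (i, j) g)"

definition F_op :: "(nat \<Rightarrow> nat) \<Rightarrow> nat \<Rightarrow> ratfun \<Rightarrow> ratfun" where
  "F_op lam i g = (\<Sum>j\<in>{1..lam i}.
     (\<Prod>a\<in>row lam (i - 1). X (i, j) - X a) / (\<Prod>b\<in>row lam i - {(i, j)}. X (i, j) - X b)
       * inv (phi (i, j)) g)"

definition divdiff :: "var \<Rightarrow> var \<Rightarrow> ratfun \<Rightarrow> ratfun" where
  "divdiff a b g = (g - perm_act (transpose a b) g) / (X a - X b)"

text \<open>
  Parts of the composition \<open>mu\<close> are numbered from 1, so that \<open>\<mu>\<^sub>j\<close> is \<open>mu ! (j - 1)\<close>.
  The function \<open>e\<close> enumerates \<open>{1..\<lambda>\<^sub>i}\<close> in increasing order as \<open>e 1, e 2, \<dots>\<close>.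
\<close>

definition part_min :: "nat list \<Rightarrow> nat \<Rightarrow> nat" where
  "part_min mu j = sum_list (take (j - 1) mu) + 1"

definition part_set :: "nat \<Rightarrow> (nat \<Rightarrow> nat) \<Rightarrow> nat list \<Rightarrow> nat \<Rightarrow> var set" where
  "part_set i e mu j = (\<lambda>t. (i, e t)) ` {part_min mu j ..< part_min mu j + mu ! (j - 1)}"

text \<open>\<open>divdiff_chain i e s n\<close> is the composition of the \<open>n\<close> divided differences for the consecutive
  pairs of \<open>e s, \<dots>, e (s + n)\<close>, the last pair being the outermost (leftmost) factor.\<close>

primrec divdiff_chain :: "nat \<Rightarrow> (nat \<Rightarrow> nat) \<Rightarrow> nat \<Rightarrow> nat \<Rightarrow> ratfun \<Rightarrow> ratfun" where
  "divdiff_chain i e s 0 = id"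
| "divdiff_chain i e s (Suc n) = divdiff (i, e (s + n)) (i, e (s + n + 1)) \<circ> divdiff_chain i e s n"

definition part_divdiff :: "nat \<Rightarrow> (nat \<Rightarrow> nat) \<Rightarrow> nat list \<Rightarrow> nat \<Rightarrow> ratfun \<Rightarrow> ratfun" where
  "part_divdiff i e mu j = divdiff_chain i e (part_min mu j) (mu ! (j - 1) - 1)"

definition f_plus :: "(nat \<Rightarrow> nat) \<Rightarrow> nat \<Rightarrow> (nat \<Rightarrow> nat) \<Rightarrow> nat list \<Rightarrow> nat \<Rightarrow> ratfun" where
  "f_plus lam i e mu j =
     (\<Prod>a\<in>row lam (i + 1). X (i, e (part_min mu j)) - X a) /
     (\<Prod>b\<in>row lam i - part_set i e mu j. X (i, e (part_min mu j)) - X b)"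

definition f_minus :: "(nat \<Rightarrow> nat) \<Rightarrow> nat \<Rightarrow> (nat \<Rightarrow> nat) \<Rightarrow> nat list \<Rightarrow> nat \<Rightarrow> ratfun" where
  "f_minus lam i e mu j =
     (\<Prod>a\<in>row lam (i - 1). X (i, e (part_min mu j)) - X a) /
     (\<Prod>b\<in>row lam i - part_set i e mu j. X (i, e (part_min mu j)) - X b)"


subsection \<open>The substitutions extend to field automorphisms\<close>

lemma Const_0 [simp]: "Const 0 = 0"
  and Const_1 [simp]: "Const 1 = 1"
  and Const_add: "Const (c + d) = Const c + Const d"
  and Const_mult: "Const (c * d) = Const c * Const d"
  by (simp_all add: Const_def single_add mult_single)

lemma subst_superset:
  assumes "finite A" "Poly_Mapping.keys p \<subseteq> A"
  shows "subst s p = (\<Sum>m\<in>A. Const (Poly_Mapping.lookup p m) * subst_monom s m)"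
  unfolding subst_def
  by (rule sum.mono_neutral_left) (use assms in \<open>auto simp: in_keys_iff\<close>)

lemma subst_monom_superset:
  assumes "finite A" "Poly_Mapping.keys m \<subseteq> A"
  shows "subst_monom s m = (\<Prod>v\<in>A. s v ^ Poly_Mapping.lookup m v)"
  unfolding subst_monom_def
  by (rule prod.mono_neutral_left) (use assms in \<open>auto simp: in_keys_iff\<close>)

lemma subst_monom_add: "subst_monom s (m + n) = subst_monom s m * subst_monom s n"
proof -
  let ?A = "Poly_Mapping.keys m \<union> Poly_Mapping.keys n"
  have "subst_monom s (m + n) = (\<Prod>v\<in>?A. s v ^ Poly_Mapping.lookup (m + n) v)"
    by (rule subst_monom_superset) (auto dest: subsetD[OF Poly_Mapping.keys_add])
  moreover have "subst_monom s m = (\<Prod>v\<in>?A. s v ^ Poly_Mapping.lookup m v)"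
    by (rule subst_monom_superset) auto
  moreover have "subst_monom s n = (\<Prod>v\<in>?A. s v ^ Poly_Mapping.lookup n v)"
    by (rule subst_monom_superset) auto
  ultimately show ?thesis
    by (simp add: lookup_add power_add prod.distrib)
qed

lemma subst_add: "subst s (p + q) = subst s p + subst s q"
proof -
  let ?A = "Poly_Mapping.keys p \<union> Poly_Mapping.keys q"
  have "subst s (p + q) = (\<Sum>m\<in>?A. Const (Poly_Mapping.lookup (p + q) m) * subst_monom s m)"
    by (rule subst_superset) (auto dest: subsetD[OF Poly_Mapping.keys_add])
  moreover have "subst s p = (\<Sum>m\<in>?A. Const (Poly_Mapping.lookup p m) * subst_monom s m)"
    by (rule subst_superset) auto
  moreover have "subst s q = (\<Sum>m\<in>?A. Const (Poly_Mapping.lookup q m) * subst_monom s m)"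
    by (rule subst_superset) auto
  ultimately show ?thesis
    by (simp add: lookup_add Const_add distrib_right sum.distrib)
qed

lemma subst_0 [simp]: "subst s 0 = 0"
  by (simp add: subst_def)

lemma subst_single: "subst s (Poly_Mapping.single m c) = Const c * subst_monom s m"
  by (cases "c = 0") (simp_all add: subst_def)

lemma subst_Const [simp]: "subst s (Const c) = Const c"
  by (simp add: Const_def subst_single[unfolded Const_def] subst_monom_def)

lemma subst_1 [simp]: "subst s 1 = 1"
  using subst_Const[of s 1] by simp

lemma subst_Var [simp]: "subst s (Var v) = s v"
  by (simp add: Var_def subst_single subst_monom_def)

lemma mpoly_induct [case_names single add]:
  fixes p :: mpoly
  assumes "\<And>m c. P (Poly_Mapping.single m c)" and "\<And>p q. P p \<Longrightarrow> P q \<Longrightarrow> P (p + q)"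
  shows "P p"
proof (induction p rule: Poly_Mapping.update_induct)
  case const
  show ?case using assms(1)[of 0 0] by simp
next
  case (update f a b)
  have "Poly_Mapping.update a b f = f + Poly_Mapping.single a b"
  proof (rule poly_mapping_eqI)
    fix k
    show "Poly_Mapping.lookup (Poly_Mapping.update a b f) k =
        Poly_Mapping.lookup (f + Poly_Mapping.single a b) k"
      using update(1) by (auto simp: lookup_update lookup_add lookup_single in_keys_iff when_def)
  qed
  with assms update show ?case by simp
qed

lemma subst_mult: "subst s (p * q) = subst s p * subst s q"
proof (induction p rule: mpoly_induct)
  case (single m c)
  show ?case
    by (induction q rule: mpoly_induct)
      (simp_all add: mult_single subst_single subst_monom_add Const_mult subst_add algebra_simps)
qed (simp_all add: subst_add algebra_simps)

lemma subst_power: "subst s (p ^ n) = subst s p ^ n"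
  by (induction n) (simp_all add: subst_mult)

lemma subst_diff: "subst s (p - q) = subst s p - subst s q"
  using subst_add[of s "p - q" q] by simp

lemma single_eq: "Poly_Mapping.single m c = Const c * subst_monom Var m"
proof -
  have "finite (Poly_Mapping.keys m)" by simp
  have pw: "Var v ^ n = Poly_Mapping.single (Poly_Mapping.single v n) 1" for v n
    by (induction n)
      (simp_all add: Var_def mult_single single_add[symmetric])
  have "(\<Prod>v\<in>A. Var v ^ Poly_Mapping.lookup m v) =
      Poly_Mapping.single (\<Sum>v\<in>A. Poly_Mapping.single v (Poly_Mapping.lookup m v)) 1"
    if "finite A" for A
    using that by induction (simp_all add: pw mult_single)
  moreover have "(\<Sum>v\<in>Poly_Mapping.keys m. Poly_Mapping.single v (Poly_Mapping.lookup m v)) = m"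
    by (rule poly_mapping_eqI)
      (auto simp: lookup_sum lookup_single when_def in_keys_iff)
  ultimately show ?thesis
    by (simp add: subst_monom_def Const_def mult_single)
qed

lemma subst_subst: "subst s (subst t p) = subst (\<lambda>v. subst s (t v)) p"
proof (induction p rule: mpoly_induct)
  case (single m c)
  have "subst s (\<Prod>v\<in>A. t v ^ g v) = (\<Prod>v\<in>A. subst s (t v) ^ g v)" for A :: "var set" and g
    by (induction A rule: infinite_finite_induct) (simp_all add: subst_mult subst_power)
  thus ?case by (simp add: subst_single subst_mult subst_monom_def)
qed (simp_all add: subst_add)

lemma subst_Var_id [simp]: "subst Var p = p"
  by (induction p rule: mpoly_induct) (simp_all add: subst_add subst_single single_eq[symmetric])

lemma map_fract_Fract:
  assumes "inj (subst s)" "q \<noteq> 0"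
  shows "map_fract (subst s) (Fract p q) = Fract (subst s p) (subst s q)"
  unfolding map_fract_def
proof (rule the_equality)
  show "\<exists>p' q'. q' \<noteq> 0 \<and> Fract p q = Fract p' q' \<and>
      Fract (subst s p) (subst s q) = Fract (subst s p') (subst s q')"
    using assms(2) by blast
next
  fix g assume "\<exists>p' q'. q' \<noteq> 0 \<and> Fract p q = Fract p' q' \<and>
      g = Fract (subst s p') (subst s q')"
  then obtain p' q' where *: "q' \<noteq> 0" "Fract p q = Fract p' q'" "g = Fract (subst s p') (subst s q')"
    by blast
  have nz: "subst s r \<noteq> 0" if "r \<noteq> 0" for r
    using injD[OF assms(1), of r 0] that by auto
  have "p * q' = p' * q" using * assms(2) by (simp add: eq_fract)
  hence "subst s p * subst s q' = subst s p' * subst s q" by (metis subst_mult)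
  thus "g = Fract (subst s p) (subst s q)" using * assms(2) nz by (simp add: eq_fract)
qed

locale subst_pair =
  fixes s t :: "var \<Rightarrow> mpoly"
  assumes st: "subst s (t v) = Var v" and ts: "subst t (s v) = Var v"
begin

lemma inj_subst: "inj (subst s)"
  by (rule inj_on_inverseI[where g = "subst t"]) (simp add: subst_subst ts)

lemma subst_nz: "p \<noteq> 0 \<Longrightarrow> subst s p \<noteq> 0"
  using injD[OF inj_subst, of p 0] by auto

lemma map_Fract: "q \<noteq> 0 \<Longrightarrow> map_fract (subst s) (Fract p q) = Fract (subst s p) (subst s q)"
  by (rule map_fract_Fract[OF inj_subst])

lemma of_mpoly: "map_fract (subst s) (of_mpoly p) = of_mpoly (subst s p)"
  by (simp add: of_mpoly_def map_Fract)

lemma add: "map_fract (subst s) (f + g) = map_fract (subst s) f + map_fract (subst s) g"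
  by (cases f, cases g) (simp add: map_Fract subst_add subst_mult subst_nz)

lemma mult: "map_fract (subst s) (f * g) = map_fract (subst s) f * map_fract (subst s) g"
  by (cases f, cases g) (simp add: map_Fract subst_mult)

end

lemma subst_pair_sym: "subst_pair s t \<Longrightarrow> subst_pair t s"
  by (simp add: subst_pair_def)

lemma (in subst_pair) inverse: "map_fract (subst t) (map_fract (subst s) f) = f"
proof (cases f)
  case (Fract p q)
  interpret ts: subst_pair t s by (rule subst_pair_sym) (rule subst_pair_axioms)
  show ?thesis using Fract by (simp add: map_Fract ts.map_Fract subst_nz subst_subst ts)
qed

lemma (in subst_pair) bij: "bij (map_fract (subst s))"
proof (rule o_bij)
  interpret ts: subst_pair t s by (rule subst_pair_sym) (rule subst_pair_axioms)
  show "map_fract (subst t) \<circ> map_fract (subst s) = id" by (auto simp: inverse)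
  show "map_fract (subst s) \<circ> map_fract (subst t) = id" by (auto simp: ts.inverse)
qed

lemma subst_pair_phi:
  "subst_pair (\<lambda>b. Var b + (if b = a then 1 else 0)) (\<lambda>b. Var b - (if b = a then 1 else 0))"
  by unfold_locales (simp_all add: subst_add subst_diff)

lemma subst_pair_perm:
  assumes "bij \<pi>"
  shows "subst_pair (\<lambda>b. Var (\<pi> b)) (\<lambda>b. Var (inv \<pi> b))"
  by unfold_locales (use assms in \<open>simp_all add: bij_is_inj bij_is_surj surj_f_inv_f\<close>)

lemma phi_add: "phi a (f + g) = phi a f + phi a g"
  and phi_mult: "phi a (f * g) = phi a f * phi a g"
  and phi_Const: "phi a (of_mpoly (Const c)) = of_mpoly (Const c)"
  and phi_X: "phi a (X b) = X b + (if b = a then 1 else 0)"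
  and bij_phi: "bij (phi a)"
  using subst_pair.add[OF subst_pair_phi] subst_pair.mult[OF subst_pair_phi]
    subst_pair.of_mpoly[OF subst_pair_phi] subst_pair.bij[OF subst_pair_phi]
  by (auto simp: phi_def X_def of_mpoly_def One_fract_def)

lemma perm_act_add: "bij \<pi> \<Longrightarrow> perm_act \<pi> (f + g) = perm_act \<pi> f + perm_act \<pi> g"
  and perm_act_mult: "bij \<pi> \<Longrightarrow> perm_act \<pi> (f * g) = perm_act \<pi> f * perm_act \<pi> g"
  and perm_act_Const: "bij \<pi> \<Longrightarrow> perm_act \<pi> (of_mpoly (Const c)) = of_mpoly (Const c)"
  and perm_act_X: "bij \<pi> \<Longrightarrow> perm_act \<pi> (X b) = X (\<pi> b)"
  and bij_perm_act: "bij \<pi> \<Longrightarrow> bij (perm_act \<pi>)"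
  using subst_pair.add[OF subst_pair_perm] subst_pair.mult[OF subst_pair_perm]
    subst_pair.of_mpoly[OF subst_pair_perm] subst_pair.bij[OF subst_pair_perm]
  by (auto simp: perm_act_def X_def)

end

theory Submission
  imports Defs
begin

text \<open>
  Both operators are sums over the variables \<open>b\<close> of row \<open>i\<close> of a term
  \<open>N b / (\<Prod>a\<in>row lam i - {b}. X b - X a) * \<psi> b g\<close>, where \<open>\<psi> b\<close> is a shift of the variable at \<open>b\<close> and
  \<open>N b\<close> is a product over an adjacent row. Cut the row into consecutive blocks. Within a block \<open>P\<close>,
  the factors of the denominator with \<open>a \<in> P\<close> are the denominators of a Lagrange interpolation
  sum, and the rest of the term, \<open>h b\<close>, is a family of rational functions that permutations of \<open>P\<close>
  permute in the same way as the variables, because \<open>g\<close> is symmetric. The sum of the terms of the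
  block is therefore the divided difference of \<open>h\<close> over all the variables of \<open>P\<close>, and Newton's
  recursion computes it by successive two-point divided differences, starting from the value of
  \<open>h\<close> at the first variable (\<open>divdiff_chain_Lagrange\<close>, \<open>divdiff_chain_op_term\<close>). Adding up the
  blocks gives the formulas.

  That symmetric polynomials are mapped to symmetric polynomials is a consequence of the same
  identity. Symmetry is visible from the sum over the whole row. For polynomiality, take the whole
  row as a single block: then the coefficient has no denominator, and divided differences preserve
  polynomials (\<open>divdiff_polys\<close>, \<open>sum_op_term_sym_polys\<close>).
\<close>

section \<open>Polynomials inside the field of rational functions\<close>

lemma of_mpoly_0 [simp]: "of_mpoly 0 = 0"
  and of_mpoly_1 [simp]: "of_mpoly 1 = 1"
  and of_mpoly_add: "of_mpoly (p + q) = of_mpoly p + of_mpoly q"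
  and of_mpoly_mult: "of_mpoly (p * q) = of_mpoly p * of_mpoly q"
  by (simp_all add: of_mpoly_def Zero_fract_def One_fract_def)

lemma of_mpoly_eq_iff: "of_mpoly p = of_mpoly q \<longleftrightarrow> p = q"
  by (simp add: of_mpoly_def eq_fract)

lemma of_mpoly_power: "of_mpoly (p ^ n) = of_mpoly p ^ n"
  by (induction n) (simp_all add: of_mpoly_mult)

lemma of_mpoly_sum: "of_mpoly (sum p A) = (\<Sum>x\<in>A. of_mpoly (p x))"
  by (induction A rule: infinite_finite_induct) (simp_all add: of_mpoly_add)

lemma of_mpoly_prod: "of_mpoly (prod p A) = (\<Prod>x\<in>A. of_mpoly (p x))"
  by (induction A rule: infinite_finite_induct) (simp_all add: of_mpoly_mult)

lemma X_eq_iff: "X a = X b \<longleftrightarrow> a = b"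
proof
  assume "X a = X b"
  hence "Poly_Mapping.keys (Var a) = Poly_Mapping.keys (Var b)"
    by (simp add: X_def of_mpoly_eq_iff)
  hence "Poly_Mapping.single a (1::nat) = Poly_Mapping.single b 1" by (simp add: Var_def)
  hence "Poly_Mapping.keys (Poly_Mapping.single a (1::nat)) = Poly_Mapping.keys (Poly_Mapping.single b (1::nat))"
    by simp
  thus "a = b" by simp
qed simp

lemma vars_add: "vars (p + q) \<subseteq> vars p \<union> vars q"
  unfolding vars_def using Poly_Mapping.keys_add[of p q] by blast

lemma vars_mult: "vars (p * q) \<subseteq> vars p \<union> vars q"
proof
  fix v assume "v \<in> vars (p * q)"
  then obtain m where "m \<in> Poly_Mapping.keys (p * q)" "v \<in> Poly_Mapping.keys m"
    by (auto simp: vars_def)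
  then obtain a b where "a \<in> Poly_Mapping.keys p" "b \<in> Poly_Mapping.keys q" "v \<in> Poly_Mapping.keys (a + b)"
    using Poly_Mapping.keys_mult[of p q] by blast
  thus "v \<in> vars p \<union> vars q"
    using Poly_Mapping.keys_add[of a b] by (auto simp: vars_def)
qed

lemma polys_Const [intro]: "of_mpoly (Const c) \<in> polys k lam"
  by (auto simp: polys_def vars_def Const_def split: if_splits intro!: imageI)

lemma polys_X [intro]: "v \<in> idx k lam \<Longrightarrow> X v \<in> polys k lam"
  by (auto simp: polys_def vars_def X_def Var_def split: if_splits intro!: imageI)

lemma polys_add: "f \<in> polys k lam \<Longrightarrow> g \<in> polys k lam \<Longrightarrow> f + g \<in> polys k lam"
  unfolding polys_def using vars_add by (fastforce simp: of_mpoly_add[symmetric])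

lemma polys_mult: "f \<in> polys k lam \<Longrightarrow> g \<in> polys k lam \<Longrightarrow> f * g \<in> polys k lam"
  unfolding polys_def using vars_mult by (fastforce simp: of_mpoly_mult[symmetric])

lemma polys_0: "0 \<in> polys k lam"
  using polys_Const[of 0] by simp

lemma polys_1: "1 \<in> polys k lam"
  using polys_Const[of 1] by simp

lemma of_mpoly_Const_minus: "of_mpoly (Const (-c)) = - of_mpoly (Const c)"
proof -
  have "of_mpoly (Const (-c)) + of_mpoly (Const c) = 0"
    by (simp add: of_mpoly_add[symmetric] Const_add[symmetric])
  thus ?thesis by (simp add: eq_neg_iff_add_eq_0)
qed

lemma polys_uminus: "f \<in> polys k lam \<Longrightarrow> - f \<in> polys k lam"
  using polys_mult[OF polys_Const[of "-1"], of f k lam] by (simp add: of_mpoly_Const_minus)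

lemma polys_diff: "f \<in> polys k lam \<Longrightarrow> g \<in> polys k lam \<Longrightarrow> f - g \<in> polys k lam"
  using polys_add[of f k lam "- g"] polys_uminus[of g k lam] by simp

lemma polys_prod: "(\<And>x. x \<in> A \<Longrightarrow> f x \<in> polys k lam) \<Longrightarrow> prod f A \<in> polys k lam"
  by (induction A rule: infinite_finite_induct) (auto intro: polys_mult polys_1)

text \<open>Shifts and permutations of variables are ring homomorphisms and divided differences satisfy
  a Leibniz rule, so that what they do to polynomials follows from what they do to constants and
  variables.\<close>

lemma polys_induct [consumes 1, case_names Const X add mult]:
  assumes f: "f \<in> polys k lam"
    and Const: "\<And>c. P (of_mpoly (Const c))"
    and X: "\<And>v. v \<in> idx k lam \<Longrightarrow> P (X v)"
    and add: "\<And>f g. f \<in> polys k lam \<Longrightarrow> g \<in> polys k lam \<Longrightarrow> P f \<Longrightarrow> P g \<Longrightarrow> P (f + g)"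
    and mult: "\<And>f g. f \<in> polys k lam \<Longrightarrow> g \<in> polys k lam \<Longrightarrow> P f \<Longrightarrow> P g \<Longrightarrow> P (f * g)"
  shows "P f"
proof -
  let ?Q = "\<lambda>f. f \<in> polys k lam \<and> P f"
  have Q_Const: "?Q (of_mpoly (Const c))" for c using Const by blast
  have Q_mult: "?Q (f * g)" if "?Q f" "?Q g" for f g using that mult polys_mult by blast
  have Q_add: "?Q (f + g)" if "?Q f" "?Q g" for f g using that add polys_add by blast
  have Q_0: "?Q 0" and Q_1: "?Q 1" using Q_Const[of 0] Q_Const[of 1] by simp_all
  have Q_pow: "?Q (f ^ n)" if "?Q f" for f n
    by (induction n) (use that Q_1 Q_mult in auto)
  have Q_prod: "?Q (prod h A)" if "\<And>x. x \<in> A \<Longrightarrow> ?Q (h x)" for h and A :: "var set"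
    using that by (induction A rule: infinite_finite_induct) (use Q_1 Q_mult in auto)
  have Q_sum: "?Q (sum h A)" if "\<And>x. x \<in> A \<Longrightarrow> ?Q (h x)" for h and A :: "(var \<Rightarrow>\<^sub>0 nat) set"
    using that by (induction A rule: infinite_finite_induct) (use Q_0 Q_add in auto)
  obtain p where p: "f = of_mpoly p" "vars p \<subseteq> idx k lam" using f by (auto simp: polys_def)
  have "f = of_mpoly (subst Var p)" using p by simp
  also have "\<dots> = (\<Sum>m\<in>Poly_Mapping.keys p. of_mpoly (Const (Poly_Mapping.lookup p m)) *
      (\<Prod>v\<in>Poly_Mapping.keys m. X v ^ Poly_Mapping.lookup m v))"
    by (simp add: subst_def subst_monom_def of_mpoly_sum of_mpoly_mult of_mpoly_prod of_mpoly_power X_def)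
  also have "?Q \<dots>"
  proof (intro Q_sum Q_mult Q_Const Q_prod Q_pow)
    fix m v assume "m \<in> Poly_Mapping.keys p" "v \<in> Poly_Mapping.keys m"
    hence "v \<in> idx k lam" using p by (auto simp: vars_def)
    thus "?Q (X v)" using X polys_X by blast
  qed
  finally show ?thesis by blast
qed


section \<open>Permutations of the variables\<close>

context
  fixes \<pi> :: "var \<Rightarrow> var"
  assumes bij: "bij \<pi>"
begin

lemma perm_act_0: "perm_act \<pi> 0 = 0"
  using perm_act_Const[OF bij, of 0] by simp

lemma perm_act_1: "perm_act \<pi> 1 = 1"
  using perm_act_Const[OF bij, of 1] by simp

lemma perm_act_diff: "perm_act \<pi> (f - g) = perm_act \<pi> f - perm_act \<pi> g"
  using perm_act_add[OF bij, of "f - g" g] by simp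

lemma perm_act_divide: "perm_act \<pi> (f / g) = perm_act \<pi> f / perm_act \<pi> g"
proof (cases "g = 0")
  case False
  hence "perm_act \<pi> g \<noteq> 0"
    using bij_is_inj[OF bij_perm_act[OF bij]] perm_act_0 by (metis injD)
  moreover have "perm_act \<pi> (f / g) * perm_act \<pi> g = perm_act \<pi> f"
    using False by (simp add: perm_act_mult[OF bij, symmetric])
  ultimately show ?thesis by (simp add: nonzero_eq_divide_eq)
qed (simp add: perm_act_0)

lemma perm_act_sum: "perm_act \<pi> (sum h A) = (\<Sum>x\<in>A. perm_act \<pi> (h x))"
  by (induction A rule: infinite_finite_induct) (simp_all add: perm_act_0 perm_act_add[OF bij])

lemma perm_act_prod: "perm_act \<pi> (prod h A) = (\<Prod>x\<in>A. perm_act \<pi> (h x))"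
  by (induction A rule: infinite_finite_induct) (simp_all add: perm_act_1 perm_act_mult[OF bij])

lemma perm_act_prod_diff:
  "perm_act \<pi> (\<Prod>b\<in>B. X a - X b) = (\<Prod>b\<in>\<pi> ` B. X (\<pi> a) - X b)"
proof -
  have "inj_on \<pi> B" using bij by (meson bij_is_inj inj_on_subset subset_UNIV)
  thus ?thesis
    by (simp add: perm_act_prod perm_act_diff perm_act_X[OF bij] prod.reindex)
qed

lemma perm_act_polys:
  assumes "\<pi> ` idx k lam \<subseteq> idx k lam" "f \<in> polys k lam"
  shows "perm_act \<pi> f \<in> polys k lam"
  using assms(2)
proof (induction rule: polys_induct)
  case (X v)
  thus ?case using assms(1) by (auto simp: perm_act_X[OF bij])
qed (auto simp: perm_act_add[OF bij] perm_act_mult[OF bij] perm_act_Const[OF bij]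
    intro: polys_add polys_mult)

end

lemma finite_row: "finite (row lam l)"
  by (simp add: row_def)

lemma GG_bij: "\<pi> \<in> GG k lam \<Longrightarrow> bij \<pi>"
  by (auto simp: GG_def intro: permutes_bij)

lemma row_subset_idx: "l \<le> k \<Longrightarrow> row lam l \<subseteq> idx k lam"
  by (cases "l = 0") (auto simp: row_def idx_def)

lemma GG_idx: "\<pi> \<in> GG k lam \<Longrightarrow> \<pi> ` idx k lam \<subseteq> idx k lam"
  by (auto simp: GG_def permutes_in_image)

lemma GG_row:
  assumes "\<pi> \<in> GG k lam" "l \<le> k"
  shows "\<pi> ` row lam l = row lam l"
proof (rule endo_inj_surj[OF finite_row])
  show "\<pi> ` row lam l \<subseteq> row lam l"
  proof
    fix y assume "y \<in> \<pi> ` row lam l"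
    then obtain b where b: "b \<in> row lam l" "y = \<pi> b" by blast
    hence "b \<in> idx k lam" using row_subset_idx assms(2) by blast
    hence "\<pi> b \<in> idx k lam" "fst (\<pi> b) = fst b" using assms(1) by (auto simp: GG_def permutes_in_image)
    thus "y \<in> row lam l" using b by (auto simp: idx_def row_def split: if_splits)
  qed
  show "inj_on \<pi> (row lam l)"
    using GG_bij[OF assms(1)] by (meson bij_is_inj inj_on_subset subset_UNIV)
qed

lemma transpose_GG:
  assumes "a \<in> row lam l" "b \<in> row lam l" "l \<le> k"
  shows "transpose a b \<in> GG k lam"
proof -
  have "a \<in> idx k lam" "b \<in> idx k lam" using assms row_subset_idx by blast+
  moreover have "fst a = fst b" using assms by (auto simp: row_def split: if_splits)
  ultimately show ?thesis
    using permutes_swap_id[of a "idx k lam" b] by (auto simp: GG_def transpose_def)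
qed


section \<open>Iterated divided differences\<close>

text \<open>Divided differences obey a twisted Leibniz rule and send variables to constants; hence they
  create no denominators.\<close>

lemma divdiff_polys:
  assumes "a \<in> idx k lam" "b \<in> idx k lam" "a \<noteq> b" "f \<in> polys k lam"
  shows "divdiff a b f \<in> polys k lam"
proof -
  let ?s = "transpose a b"
  have bij: "bij ?s" by simp
  have s: "perm_act ?s f \<in> polys k lam" if "f \<in> polys k lam" for f
    by (rule perm_act_polys[OF bij _ that]) (use assms(1,2) in \<open>auto simp: transpose_def\<close>)
  have nz: "X a - X b \<noteq> 0" using assms(3) by (simp add: X_eq_iff)
  show ?thesis
    using assms(4)
  proof (induction rule: polys_induct)
    case (Const c)
    show ?case by (simp add: divdiff_def perm_act_Const[OF bij] polys_0)
  next
    case (X v)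
    have "divdiff a b (X v) = (if v = a then 1 else if v = b then - 1 else 0)"
      using nz assms(3) by (auto simp: divdiff_def perm_act_X[OF bij] transpose_def field_simps)
    thus ?case by (simp add: polys_0 polys_1 polys_uminus)
  next
    case (add f g)
    have "divdiff a b (f + g) = divdiff a b f + divdiff a b g"
      by (simp add: divdiff_def perm_act_add[OF bij] diff_divide_distrib add_divide_distrib)
    thus ?case using add by (simp add: polys_add)
  next
    case (mult f g)
    have "divdiff a b (f * g) = divdiff a b f * g + perm_act ?s f * divdiff a b g"
      using nz by (simp add: divdiff_def perm_act_mult[OF bij] divide_simps) (simp add: algebra_simps)
    thus ?case using mult s by (simp add: polys_add polys_mult)
  qed
qed

lemma divdiff_chain_polys:
  assumes "f \<in> polys k lam" "inj_on e {s..s + n}" "\<And>t. t \<in> {s..s + n} \<Longrightarrow> (i, e t) \<in> idx k lam"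
  shows "divdiff_chain i e s n f \<in> polys k lam"
  using assms(2,3)
proof (induction n)
  case (Suc n)
  have "inj_on e {s..s + n}" using Suc.prems(1) by (rule inj_on_subset) auto
  hence "divdiff_chain i e s n f \<in> polys k lam" using Suc by auto
  moreover have "e (s + n) \<noteq> e (s + n + 1)" using Suc.prems(1) by (auto dest: inj_onD)
  ultimately show ?case using Suc.prems(2) by (auto intro!: divdiff_polys)
qed (use assms(1) in auto)

text \<open>
  This is Newton's divided difference over the nodes \<open>x\<^sub>t = X (i, e t)\<close>, written as a Lagrange sum.
  The values \<open>h t\<close> are rational functions that the transposition of two nodes permutes along with
  the nodes. The transposition of the last node with the new one turns the last summand into a summand
  for the new node and only changes one factor of the denominator in the others; there the step is the partial
  fraction identity
  \<open>1 / (x\<^sub>m - x\<^sub>p) * (1 / (x\<^sub>t - x\<^sub>m) - 1 / (x\<^sub>t - x\<^sub>p)) = 1 / ((x\<^sub>t - x\<^sub>m) * (x\<^sub>t - x\<^sub>p))\<close>.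
\<close>

lemma divdiff_chain_Lagrange:
  assumes "inj_on e {s..s + n}"
    and "\<And>u v t. u \<in> {s..s + n} \<Longrightarrow> v \<in> {s..s + n} \<Longrightarrow> t \<in> {s..s + n} \<Longrightarrow>
      perm_act (transpose (i, e u) (i, e v)) (h t) = h (transpose u v t)"
  shows "divdiff_chain i e s n (h s) =
    (\<Sum>t\<in>{s..s + n}. h t / (\<Prod>u\<in>{s..s + n} - {t}. X (i, e t) - X (i, e u)))"
  using assms
proof (induction n)
  case 0
  show ?case by simp
next
  case (Suc n)
  define x where "x = (\<lambda>t. X (i, e t))"
  define m p T where "m = s + n" and "p = s + n + 1" and "T = {s..<m}"
  have inj: "inj_on e {s..s + n}" using Suc.prems(1) by (rule inj_on_subset) auto
  have sets: "{s..s + n} = insert m T" "{s..s + Suc n} = insert p (insert m T)"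
    "m \<notin> T" "p \<notin> T" "m \<noteq> p" "finite T"
    by (auto simp: m_def p_def T_def)
  have IH: "divdiff_chain i e s n (h s) =
    (\<Sum>t\<in>insert m T. h t / (\<Prod>u\<in>insert m T - {t}. x t - x u))"
    using Suc.IH[OF inj] Suc.prems(2) unfolding x_def sets(1)[symmetric] by simp
  define \<sigma> where "\<sigma> = transpose (i, e m) (i, e p)"
  have bij: "bij \<sigma>" by (simp add: \<sigma>_def)
  define D where "D = (\<lambda>q. (\<Sum>t\<in>T. h t / ((x t - x q) * (\<Prod>u\<in>T - {t}. x t - x u)))
      + h q / (\<Prod>u\<in>T. x q - x u))"
  have ne: "e u \<noteq> e v" if "u \<in> insert p (insert m T)" "v \<in> insert p (insert m T)" "u \<noteq> v" for u v
    using Suc.prems(1) that unfolding sets(2) inj_on_def by blast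
  hence xne: "x u \<noteq> x v" if "u \<in> insert p (insert m T)" "v \<in> insert p (insert m T)" "u \<noteq> v" for u v
    using that by (simp add: x_def X_eq_iff)
  have split: "(\<Prod>u\<in>insert q T - {t}. x t - x u) = (x t - x q) * (\<Prod>u\<in>T - {t}. x t - x u)"
    if "t \<in> T" "q \<notin> T" for t q
  proof -
    have "insert q T - {t} = insert q (T - {t})" using that by auto
    thus ?thesis using that sets(6) by simp
  qed
  have Dm: "divdiff_chain i e s n (h s) = D m"
  proof -
    have "insert m T - {m} = T" using sets by auto
    thus ?thesis unfolding IH D_def using sets by (simp add: split add.commute)
  qed
  have \<sigma>x: "perm_act \<sigma> (x t) = x t" if "t \<in> T" for t
  proof -
    have "t \<noteq> m" "t \<noteq> p" using that sets by auto
    hence "e t \<noteq> e m" "e t \<noteq> e p" using ne that by auto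
    hence "\<sigma> (i, e t) = (i, e t)" by (simp add: \<sigma>_def transpose_def)
    thus ?thesis by (simp add: x_def perm_act_X[OF bij])
  qed
  have \<sigma>m: "perm_act \<sigma> (x m) = x p"
  proof -
    have "\<sigma> (i, e m) = (i, e p)" by (simp add: \<sigma>_def)
    thus ?thesis by (simp add: x_def perm_act_X[OF bij])
  qed
  have \<sigma>h: "perm_act \<sigma> (h t) = h t" if "t \<in> T" for t
  proof -
    have "t \<noteq> m" "t \<noteq> p" using that sets by auto
    hence "transpose m p t = t" by simp
    moreover have "perm_act \<sigma> (h t) = h (transpose m p t)"
      unfolding \<sigma>_def by (rule Suc.prems(2)) (use that sets in auto)
    ultimately show ?thesis by simp
  qed
  have \<sigma>hm: "perm_act \<sigma> (h m) = h p"
  proof -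
    have "perm_act \<sigma> (h m) = h (transpose m p m)"
      unfolding \<sigma>_def by (rule Suc.prems(2)) (use sets in auto)
    thus ?thesis by simp
  qed
  have \<sigma>D: "perm_act \<sigma> (D m) = D p"
    unfolding D_def
    by (auto simp: perm_act_add[OF bij] perm_act_sum[OF bij] perm_act_divide[OF bij]
        perm_act_mult[OF bij] perm_act_prod[OF bij] perm_act_diff[OF bij] \<sigma>x \<sigma>h \<sigma>m \<sigma>hm
        intro!: sum.cong prod.cong arg_cong2[where f = "(+)"] arg_cong2[where f = "(/)"]
          arg_cong2[where f = "(*)"])
  have mp: "x m - x p \<noteq> 0" "x p - x m \<noteq> 0" using xne[of m p] sets by auto
  \<comment> \<open>\<open>c\<close> stands for the product of the remaining factors, which the step leaves unchanged.\<close>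
  have pf: "(h t / ((x t - x m) * c) - h t / ((x t - x p) * c)) / (x m - x p)
      = h t / ((x t - x p) * ((x t - x m) * c))" if "t \<in> T" for t c
  proof -
    have "t \<noteq> m" "t \<noteq> p" using that sets by auto
    hence "x t - x m \<noteq> 0" "x t - x p \<noteq> 0" using xne[of t m] xne[of t p] that by auto
    thus ?thesis using mp
      by (cases "c = 0") (simp_all add: divide_simps, simp add: algebra_simps)
  qed
  have "divdiff_chain i e s (Suc n) (h s) = (D m - D p) / (x m - x p)"
    using \<sigma>D by (simp add: Dm divdiff_def x_def \<sigma>_def m_def p_def)
  also have "D m - D p = (\<Sum>t\<in>T. h t / ((x t - x m) * (\<Prod>u\<in>T - {t}. x t - x u))
        - h t / ((x t - x p) * (\<Prod>u\<in>T - {t}. x t - x u)))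
      + (h m / (\<Prod>u\<in>T. x m - x u) - h p / (\<Prod>u\<in>T. x p - x u))"
    by (simp add: D_def sum_subtractf)
  also have "\<dots> / (x m - x p) =
      (\<Sum>t\<in>T. h t / ((x t - x p) * ((x t - x m) * (\<Prod>u\<in>T - {t}. x t - x u))))
      + (h m / ((x m - x p) * (\<Prod>u\<in>T. x m - x u)) + h p / ((x p - x m) * (\<Prod>u\<in>T. x p - x u)))"
  proof -
    have "(h m / a - h p / b) / (x m - x p) = h m / ((x m - x p) * a) + h p / ((x p - x m) * b)"
      for a b
    proof -
      have "h p / ((x p - x m) * b) = - (h p / ((x m - x p) * b))"
        by (metis divide_minus_right minus_diff_eq mult_minus_left)
      thus ?thesis by (simp add: diff_divide_distrib mult.commute)
    qed
    thus ?thesis by (simp add: add_divide_distrib sum_divide_distrib pf)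
  qed
  also have "\<dots> = (\<Sum>t\<in>insert p (insert m T). h t / (\<Prod>u\<in>insert p (insert m T) - {t}. x t - x u))"
  proof -
    have "insert p (insert m T) - {p} = insert m T" "insert p (insert m T) - {m} = insert p T"
      using sets by auto
    moreover have "(\<Prod>u\<in>insert p (insert m T) - {t}. x t - x u)
        = (x t - x p) * ((x t - x m) * (\<Prod>u\<in>T - {t}. x t - x u))" if "t \<in> T" for t
    proof -
      have "insert p (insert m T) - {t} = insert p (insert m (T - {t}))" using that sets by auto
      thus ?thesis using sets by simp
    qed
    ultimately show ?thesis using sets by (simp add: ac_simps)
  qed
  finally show ?case unfolding sets(2) x_def .
qed


section \<open>Sums of shift operators over one row\<close>

lemma sum_over_parts:
  fixes F :: "nat \<Rightarrow> 'a :: comm_monoid_add"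
  shows "(\<Sum>t\<in>{1..sum_list mu}. F t) =
    (\<Sum>j\<in>{1..length mu}. \<Sum>t\<in>{part_min mu j..<part_min mu j + mu ! (j - 1)}. F t)"
proof (induction mu rule: rev_induct)
  case (snoc m mu)
  have "{1..sum_list mu + m} = {1..sum_list mu} \<union> {sum_list mu + 1..<sum_list mu + 1 + m}" by auto
  hence "(\<Sum>t\<in>{1..sum_list mu + m}. F t) =
      (\<Sum>t\<in>{1..sum_list mu}. F t) + (\<Sum>t\<in>{sum_list mu + 1..<sum_list mu + 1 + m}. F t)"
    by (simp only:) (rule sum.union_disjoint, auto)
  also have "(\<Sum>t\<in>{1..sum_list mu}. F t) = (\<Sum>j\<in>{1..length mu}.
      \<Sum>t\<in>{part_min (mu @ [m]) j..<part_min (mu @ [m]) j + (mu @ [m]) ! (j - 1)}. F t)"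
    unfolding snoc
  proof (rule sum.cong)
    fix j assume "j \<in> {1..length mu}"
    hence "part_min (mu @ [m]) j = part_min mu j" "(mu @ [m]) ! (j - 1) = mu ! (j - 1)"
      by (auto simp: part_min_def nth_append)
    thus "(\<Sum>t\<in>{part_min mu j..<part_min mu j + mu ! (j - 1)}. F t) =
        (\<Sum>t\<in>{part_min (mu @ [m]) j..<part_min (mu @ [m]) j + (mu @ [m]) ! (j - 1)}. F t)"
      by simp
  qed simp
  also have "{sum_list mu + 1..<sum_list mu + 1 + m} = {part_min (mu @ [m]) (length mu + 1)..<
      part_min (mu @ [m]) (length mu + 1) + (mu @ [m]) ! (length mu + 1 - 1)}"
    by (simp add: part_min_def)
  finally show ?case by (simp del: sum.op_ivl_Suc)
qed simp

text \<open>The raising and the lowering operators are treated together: \<open>\<psi> b\<close> is a shift of the variable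
  \<open>X b\<close> by a constant, and \<open>r\<close> is the row that contributes the numerators.\<close>

locale row_shift =
  fixes k :: nat and lam :: "nat \<Rightarrow> nat" and i r :: nat and \<psi> :: "var \<Rightarrow> ratfun \<Rightarrow> ratfun" and c :: ratfun
  assumes i: "1 \<le> i" "i \<le> k" and r: "r \<le> k"
    and c: "c = 1 \<or> c = - 1"
    and \<psi>_add: "\<psi> b (f + g) = \<psi> b f + \<psi> b g"
    and \<psi>_mult: "\<psi> b (f * g) = \<psi> b f * \<psi> b g"
    and \<psi>_Const: "\<psi> b (of_mpoly (Const z)) = of_mpoly (Const z)"
    and \<psi>_X: "\<psi> b (X a) = X a + (if a = b then c else 0)"
begin

text \<open>The set \<open>B\<close> of variables of the denominator is a parameter because the operators remove one
  variable from the row, while the coefficients of the divided differences remove a whole block.\<close>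

definition op_term :: "var set \<Rightarrow> ratfun \<Rightarrow> var \<Rightarrow> ratfun" where
  "op_term B g b = (\<Prod>a\<in>row lam r. X b - X a) / (\<Prod>a\<in>B. X b - X a) * \<psi> b g"

lemma \<psi>_polys: "f \<in> polys k lam \<Longrightarrow> \<psi> b f \<in> polys k lam"
proof (induction rule: polys_induct)
  case (X v)
  thus ?case using c by (auto simp: \<psi>_X intro!: polys_add polys_X polys_diff polys_1 polys_uminus)
qed (auto simp: \<psi>_add \<psi>_mult \<psi>_Const intro: polys_add polys_mult)

lemma perm_act_\<psi>:
  assumes \<pi>: "bij \<pi>" and "f \<in> polys k lam"
  shows "perm_act \<pi> (\<psi> b f) = \<psi> (\<pi> b) (perm_act \<pi> f)"
  using assms(2)
proof (induction rule: polys_induct)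
  case (X v)
  have "perm_act \<pi> c = c"
    using c perm_act_diff[OF \<pi>, of 0 1] by (auto simp: perm_act_0[OF \<pi>] perm_act_1[OF \<pi>])
  moreover have "\<pi> v = \<pi> b \<longleftrightarrow> v = b" using bij_is_inj[OF \<pi>] by (auto dest: injD)
  ultimately show ?case
    by (auto simp: \<psi>_X perm_act_add[OF \<pi>] perm_act_X[OF \<pi>] perm_act_0[OF \<pi>])
qed (simp_all add: \<psi>_add \<psi>_mult \<psi>_Const perm_act_add[OF \<pi>] perm_act_mult[OF \<pi>] perm_act_Const[OF \<pi>])

lemma perm_act_op_term:
  assumes "\<pi> \<in> GG k lam" "g \<in> sym_polys k lam"
  shows "perm_act \<pi> (op_term B g b) = op_term (\<pi> ` B) g (\<pi> b)"
proof -
  note \<pi> = GG_bij[OF assms(1)]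
  have "g \<in> polys k lam" "perm_act \<pi> g = g" using assms by (auto simp: sym_polys_def)
  thus ?thesis
    unfolding op_term_def
    by (simp add: perm_act_mult[OF \<pi>] perm_act_divide[OF \<pi>] perm_act_prod_diff[OF \<pi>]
        perm_act_\<psi>[OF \<pi>] GG_row[OF assms(1) r])
qed

text \<open>The factors of the full denominator that belong to nodes of the block are exactly those of
  the Lagrange formula; the others stay in the coefficient, which is therefore symmetric in the
  nodes of the block.\<close>

lemma divdiff_chain_op_term:
  assumes g: "g \<in> sym_polys k lam" and inj: "inj_on e {1..lam i}" and e: "e ` {1..lam i} \<subseteq> {1..lam i}"
    and sn: "{s..s + n} \<subseteq> {1..lam i}"
  shows "divdiff_chain i e s n
      (op_term (row lam i - (\<lambda>t. (i, e t)) ` {s..s + n}) g (i, e s)) =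
    (\<Sum>t\<in>{s..s + n}. op_term (row lam i - {(i, e t)}) g (i, e t))"
proof -
  define S where "S = {s..s + n}"
  define P where "P = (\<lambda>t. (i, e t)) ` S"
  have injS: "inj_on e S" using inj sn unfolding S_def by (rule inj_on_subset)
  have row: "(i, e t) \<in> row lam i" if "t \<in> S" for t
  proof -
    have "t \<in> {1..lam i}" using that sn unfolding S_def by (rule subsetD[rotated])
    hence "e t \<in> {1..lam i}" using e by blast
    thus ?thesis using i by (simp add: row_def)
  qed
  have eq: "perm_act (transpose (i, e u) (i, e v)) (op_term (row lam i - P) g (i, e t))
      = op_term (row lam i - P) g (i, e (transpose u v t))"
    if "u \<in> S" "v \<in> S" "t \<in> S" for u v t
  proof -
    have "transpose (i, e u) (i, e v) ` (row lam i - P) = row lam i - P"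
    proof -
      have "transpose (i, e u) (i, e v) b = b" if "b \<in> row lam i - P" for b
        using that \<open>u \<in> S\<close> \<open>v \<in> S\<close> by (auto simp: P_def transpose_def)
      thus ?thesis by force
    qed
    moreover have "transpose (i, e u) (i, e v) (i, e t) = (i, e (transpose u v t))"
      using that injS by (auto simp: transpose_def dest: inj_onD)
    ultimately show ?thesis
      using that by (simp add: perm_act_op_term[OF transpose_GG[OF row row i(2)] g])
  qed
  have "divdiff_chain i e s n (op_term (row lam i - P) g (i, e s)) =
      (\<Sum>t\<in>S. op_term (row lam i - P) g (i, e t) / (\<Prod>u\<in>S - {t}. X (i, e t) - X (i, e u)))"
    unfolding S_def
    by (rule divdiff_chain_Lagrange[where h = "\<lambda>t. op_term (row lam i - P) g (i, e t)"])
      (use injS eq in \<open>auto simp: S_def\<close>)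
  also have "\<dots> = (\<Sum>t\<in>S. op_term (row lam i - {(i, e t)}) g (i, e t))"
  proof (rule sum.cong)
    fix t assume t: "t \<in> S"
    have "(\<Prod>b\<in>P - {(i, e t)}. X (i, e t) - X b) = (\<Prod>u\<in>S - {t}. X (i, e t) - X (i, e u))"
    proof -
      have "P - {(i, e t)} = (\<lambda>u. (i, e u)) ` (S - {t})"
        using t injS by (auto simp: P_def dest: inj_onD)
      moreover have "inj_on (\<lambda>u. (i, e u)) (S - {t})"
        using injS by (auto simp: inj_on_def)
      ultimately show ?thesis by (simp add: prod.reindex)
    qed
    moreover have "row lam i - {(i, e t)} = (row lam i - P) \<union> (P - {(i, e t)})"
      using row t by (auto simp: P_def)
    moreover have "(\<Prod>b\<in>(row lam i - P) \<union> (P - {(i, e t)}). X (i, e t) - X b) =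
        (\<Prod>b\<in>row lam i - P. X (i, e t) - X b) * (\<Prod>b\<in>P - {(i, e t)}. X (i, e t) - X b)"
      by (rule prod.union_disjoint) (auto simp: P_def S_def finite_row)
    ultimately show "op_term (row lam i - P) g (i, e t) / (\<Prod>u\<in>S - {t}. X (i, e t) - X (i, e u)) =
        op_term (row lam i - {(i, e t)}) g (i, e t)"
      by (simp add: op_term_def)
  qed simp
  finally show ?thesis by (simp add: S_def P_def)
qed

text \<open>Taking the whole row as one block, no denominator is left in the coefficient, and divided
  differences of polynomials are polynomials.\<close>

lemma sum_op_term_sym_polys:
  assumes g: "g \<in> sym_polys k lam" and pos: "lam i > 0"
  shows "(\<Sum>b\<in>row lam i. op_term (row lam i - {b}) g b) \<in> sym_polys k lam"
proof -
  let ?E = "\<Sum>b\<in>row lam i. op_term (row lam i - {b}) g b"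
  have sub: "row lam i \<subseteq> idx k lam" "row lam r \<subseteq> idx k lam" using row_subset_idx i r by auto
  have rowi: "row lam i = (\<lambda>t. (i, t)) ` {1..lam i}" using i by (auto simp: row_def)
  have len: "{1..1 + (lam i - 1)} = {1..lam i}" using pos by auto
  have "?E = (\<Sum>t\<in>{1..lam i}. op_term (row lam i - {(i, id t)}) g (i, id t))"
    unfolding rowi by (subst sum.reindex) (auto simp: inj_on_def)
  also have "\<dots> = divdiff_chain i id 1 (lam i - 1)
      (op_term (row lam i - (\<lambda>t. (i, id t)) ` {1..lam i}) g (i, id 1))"
    using divdiff_chain_op_term[OF g, of id 1 "lam i - 1"] len by simp
  also have "row lam i - (\<lambda>t. (i, id t)) ` {1..lam i} = {}" using rowi by auto
  also have "divdiff_chain i id 1 (lam i - 1) (op_term {} g (i, id 1)) \<in> polys k lam"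
  proof (rule divdiff_chain_polys)
    have "(i, id 1) \<in> idx k lam" using sub pos rowi by auto
    thus "op_term {} g (i, id 1) \<in> polys k lam"
      using g sub unfolding op_term_def
      by (auto simp: sym_polys_def intro!: polys_mult polys_prod polys_diff polys_X \<psi>_polys)
  qed (use sub pos rowi len in auto)
  finally have "?E \<in> polys k lam" .
  moreover have "perm_act \<pi> ?E = ?E" if \<pi>: "\<pi> \<in> GG k lam" for \<pi>
  proof -
    note bij = GG_bij[OF \<pi>] and row = GG_row[OF \<pi> i(2)]
    have inj: "inj \<pi>" using bij by (rule bij_is_inj)
    have "perm_act \<pi> ?E = (\<Sum>b\<in>row lam i. op_term (row lam i - {\<pi> b}) g (\<pi> b))"
      using row by (simp add: perm_act_sum[OF bij] perm_act_op_term[OF \<pi> g] image_set_diff[OF inj])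
    also have "\<dots> = (\<Sum>b\<in>\<pi> ` row lam i. op_term (row lam i - {b}) g b)"
      using inj by (subst sum.reindex) (auto intro: inj_on_subset)
    finally show ?thesis using row by simp
  qed
  ultimately show ?thesis by (simp add: sym_polys_def)
qed

lemma sum_op_term_eq_sum_parts:
  assumes g: "g \<in> sym_polys k lam" and e: "bij_betw e {1..lam i} {1..lam i}"
    and mu: "\<forall>m\<in>set mu. m > 0" "sum_list mu = lam i"
  shows "(\<Sum>b\<in>row lam i. op_term (row lam i - {b}) g b) =
    (\<Sum>j\<in>{1..length mu}. part_divdiff i e mu j
      (op_term (row lam i - part_set i e mu j) g (i, e (part_min mu j))))"
proof -
  define H where "H t = op_term (row lam i - {(i, e t)}) g (i, e t)" for t
  have "bij_betw (Pair i) {1..lam i} (row lam i)"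
    using i by (auto simp: row_def bij_betw_def inj_on_def)
  with e have "bij_betw (Pair i \<circ> e) {1..lam i} (row lam i)" by (rule bij_betw_trans)
  hence "(\<Sum>t\<in>{1..lam i}. H t) = (\<Sum>b\<in>row lam i. op_term (row lam i - {b}) g b)"
    unfolding H_def
    by (subst sum.reindex_bij_betw[symmetric, where h = "Pair i \<circ> e"]) auto
  moreover have "(\<Sum>t\<in>{part_min mu j..<part_min mu j + mu ! (j - 1)}. H t) =
      part_divdiff i e mu j (op_term (row lam i - part_set i e mu j) g (i, e (part_min mu j)))"
    if j: "j \<in> {1..length mu}" for j
  proof -
    have pos: "mu ! (j - 1) > 0" using mu(1) j by auto
    hence set: "{part_min mu j..<part_min mu j + mu ! (j - 1)} =
        {part_min mu j..part_min mu j + (mu ! (j - 1) - 1)}" by auto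
    have "take j mu = take (j - 1) mu @ [mu ! (j - 1)]"
      using j take_Suc_conv_app_nth[of "j - 1" mu] by auto
    hence "sum_list (take (j - 1) mu) + mu ! (j - 1) = sum_list (take j mu)" by simp
    also have "\<dots> \<le> sum_list mu"
      by (metis append_take_drop_id le_add1 sum_list_append)
    finally have "{part_min mu j..part_min mu j + (mu ! (j - 1) - 1)} \<subseteq> {1..lam i}"
      using mu(2) pos by (auto simp: part_min_def)
    from divdiff_chain_op_term[OF g _ _ this, of e] e show ?thesis
      unfolding part_divdiff_def part_set_def set H_def by (simp add: bij_betw_def)
  qed
  ultimately show ?thesis
    using sum_over_parts[of H mu] mu(2) by simp
qed

end

lemma row_shift_phi:
  assumes "i \<in> {1..k - 1}"
  shows "row_shift k i (i + 1) phi 1"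
  using assms by unfold_locales (auto simp: phi_add phi_mult phi_Const phi_X)

lemma row_shift_inv_phi:
  assumes "i \<in> {1..k - 1}"
  shows "row_shift k i (i - 1) (\<lambda>b. inv (phi b)) (- 1)"
proof -
  have inv: "phi b (inv (phi b) f) = f" for b f
    using bij_phi by (simp add: bij_is_surj surj_f_inv_f)
  have eqI: "inv (phi b) f = g" if "phi b g = f" for b f g
    using inv_f_f[OF bij_is_inj[OF bij_phi], of b g] that by simp
  have "inv (phi b) (X a) = X a + (if a = b then - 1 else 0)" for a b
  proof (rule eqI)
    have "phi b (- 1) = - 1"
      using phi_Const[of b "- 1"] by (simp add: of_mpoly_Const_minus)
    moreover have "phi b 0 = 0" using phi_Const[of b 0] by simp
    ultimately show "phi b (X a + (if a = b then - 1 else 0)) = X a"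
      by (simp add: phi_add phi_X)
  qed
  thus ?thesis
    using assms by unfold_locales (auto intro: eqI simp: phi_add phi_mult phi_Const inv)
qed

theorem proposition7:
  fixes k i :: nat and lam e :: "nat \<Rightarrow> nat" and prec :: "(nat \<times> nat) set" and mu :: "nat list"
  assumes "k \<ge> 1"
    and "\<forall>l\<in>{1..k}. lam l > 0"
    and "i \<in> {1..k - 1}"
    and "prec \<subseteq> {1..lam i} \<times> {1..lam i}"
    and "strict_linear_order_on {1..lam i} prec"
    and "bij_betw e {1..lam i} {1..lam i}"
    and "\<forall>s\<in>{1..lam i}. \<forall>t\<in>{1..lam i}. s < t \<longrightarrow> (e s, e t) \<in> prec"
    and "\<forall>m\<in>set mu. m > 0"
    and "sum_list mu = lam i"
  shows "\<forall>g\<in>sym_polys k lam.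
           E_op lam i g \<in> sym_polys k lam \<and>
           E_op lam i g = (\<Sum>j\<in>{1..length mu}.
             (part_divdiff i e mu j \<circ> (*) (f_plus lam i e mu j) \<circ> phi (i, e (part_min mu j))) g) \<and>
           F_op lam i g \<in> sym_polys k lam \<and>
           F_op lam i g = (\<Sum>j\<in>{1..length mu}.
             (part_divdiff i e mu j \<circ> (*) (f_minus lam i e mu j) \<circ> inv (phi (i, e (part_min mu j)))) g)"
proof
  fix g assume g: "g \<in> sym_polys k lam"
  interpret E: row_shift k lam i "i + 1" phi 1
    by (rule row_shift_phi) (rule assms(3))
  interpret F: row_shift k lam i "i - 1" "\<lambda>b. inv (phi b)" "- 1"
    by (rule row_shift_inv_phi) (rule assms(3))
  have pos: "lam i > 0" using assms(2,3) by auto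
  have row: "row lam i = Pair i ` {1..lam i}" using E.i by (auto simp: row_def)
  have E_eq: "E_op lam i g = (\<Sum>b\<in>row lam i. E.op_term (row lam i - {b}) g b)"
    unfolding E_op_def E.op_term_def row by (simp add: sum.reindex inj_on_def)
  have F_eq: "F_op lam i g = (\<Sum>b\<in>row lam i. F.op_term (row lam i - {b}) g b)"
    unfolding F_op_def F.op_term_def row by (simp add: sum.reindex inj_on_def)
  show "E_op lam i g \<in> sym_polys k lam \<and>
    E_op lam i g = (\<Sum>j\<in>{1..length mu}.
      (part_divdiff i e mu j \<circ> (*) (f_plus lam i e mu j) \<circ> phi (i, e (part_min mu j))) g) \<and>
    F_op lam i g \<in> sym_polys k lam \<and>
    F_op lam i g = (\<Sum>j\<in>{1..length mu}.
      (part_divdiff i e mu j \<circ> (*) (f_minus lam i e mu j) \<circ> inv (phi (i, e (part_min mu j)))) g)"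
  proof (intro conjI)
    show "E_op lam i g \<in> sym_polys k lam"
      unfolding E_eq by (rule E.sum_op_term_sym_polys[OF g pos])
    show "F_op lam i g \<in> sym_polys k lam"
      unfolding F_eq by (rule F.sum_op_term_sym_polys[OF g pos])
    show "E_op lam i g = (\<Sum>j\<in>{1..length mu}.
        (part_divdiff i e mu j \<circ> (*) (f_plus lam i e mu j) \<circ> phi (i, e (part_min mu j))) g)"
      unfolding E_eq E.sum_op_term_eq_sum_parts[OF g assms(6,8,9)]
      unfolding E.op_term_def f_plus_def
      by simp
    show "F_op lam i g = (\<Sum>j\<in>{1..length mu}.
        (part_divdiff i e mu j \<circ> (*) (f_minus lam i e mu j) \<circ> inv (phi (i, e (part_min mu j)))) g)"
      unfolding F_eq F.sum_op_term_eq_sum_parts[OF g assms(6,8,9)]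
      unfolding F.op_term_def f_minus_def
      by simp
  qed
qed

end
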